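(* Let $r\ge1$ and let $F$ be an $r$-degenerate graph that is a blow-up of a (finite) tree. Then there is a constant $C$ depending only on $F$ such that $\mathrm{ex}(n,F)\le C n^{2-\frac{1}{r}}$ for all $n$.
   Context: For a graph $F$, $\mathrm{ex}(n,F)$ denotes the maximum number of edges in a simple graph on $n$ vertices that does not contain $F$ as a subgraph. A graph is $r$-degenerate if each of its subgraphs has minimum degree at most $r$. A graph $F$ is a blow-up of a graph $T$ if $F$ is obtained from $T$ by replacing each vertex $u$ of $T$ by an independent set $I(u)$ (of arbitrary positive size), the sets being pairwise disjoint, and replacing each edge $uv$ of $T$ by the complete bipartite graph between $I(u)$ and $I(v)$ (with no other edges). *)

theory Defs
  imports Complex_Main "HOL-Library.Disjoint_Sets"
begin

record 'a graph =
  verts :: "'a set"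
  edges :: "'a set set"

definition simple_graph :: "'a graph \<Rightarrow> bool" where
  "simple_graph G \<longleftrightarrow> finite (verts G) \<and> (\<forall>e\<in>edges G. e \<subseteq> verts G \<and> card e = 2)"

definition subgraph :: "'a graph \<Rightarrow> 'a graph \<Rightarrow> bool" where
  "subgraph H G \<longleftrightarrow> simple_graph H \<and> verts H \<subseteq> verts G \<and> edges H \<subseteq> edges G"

definition degree :: "'a graph \<Rightarrow> 'a \<Rightarrow> nat" where
  "degree G v = card {e \<in> edges G. v \<in> e}"

definition min_degree :: "'a graph \<Rightarrow> nat" where
  "min_degree G = Min (degree G ` verts G)"

text \<open>Subgraphs without vertices have no minimum degree and are left out.\<close>

definition degenerate :: "nat \<Rightarrow> 'a graph \<Rightarrow> bool" where
  "degenerate r G \<longleftrightarrow> (\<forall>H. subgraph H G \<and> verts H \<noteq> {} \<longrightarrow> min_degree H \<le> r)"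

definition adjacency :: "'a graph \<Rightarrow> 'a rel" where
  "adjacency G = {(u, v). {u, v} \<in> edges G}"

definition connected_graph :: "'a graph \<Rightarrow> bool" where
  "connected_graph G \<longleftrightarrow>
     verts G \<noteq> {} \<and> (\<forall>u\<in>verts G. \<forall>v\<in>verts G. (u, v) \<in> (adjacency G)\<^sup>*)"

definition is_cycle :: "'a graph \<Rightarrow> 'a list \<Rightarrow> bool" where
  "is_cycle G c \<longleftrightarrow> length c \<ge> 3 \<and> distinct c \<and>
     (\<forall>i<length c. {c ! i, c ! (Suc i mod length c)} \<in> edges G)"

definition tree :: "'a graph \<Rightarrow> bool" where
  "tree G \<longleftrightarrow> simple_graph G \<and> connected_graph G \<and> (\<nexists>c. is_cycle G c)"

definition blow_up :: "'a graph \<Rightarrow> 'b graph \<Rightarrow> bool" where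
  "blow_up F T \<longleftrightarrow> (\<exists>I :: 'b \<Rightarrow> 'a set.
     (\<forall>u\<in>verts T. I u \<noteq> {}) \<and> disjoint_family_on I (verts T) \<and>
     verts F = (\<Union>u\<in>verts T. I u) \<and>
     edges F = {{x, y} | x y u v. {u, v} \<in> edges T \<and> x \<in> I u \<and> y \<in> I v})"

text \<open>A copy of \<open>F\<close> in \<open>G\<close> as a subgraph, not necessarily induced.\<close>

definition contains_graph :: "'b graph \<Rightarrow> 'a graph \<Rightarrow> bool" where
  "contains_graph G F \<longleftrightarrow> (\<exists>f. inj_on f (verts F) \<and> f ` verts F \<subseteq> verts G \<and>
     (\<forall>e\<in>edges F. f ` e \<in> edges G))"

definition free_graphs :: "nat \<Rightarrow> 'a graph \<Rightarrow> nat graph set" where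
  "free_graphs n F = {G. simple_graph G \<and> verts G = {..<n} \<and> \<not> contains_graph G F}"

text \<open>
  The supremum is a maximum as soon as some graph on \<open>n\<close> vertices is free of \<open>F\<close>
  (see below). This fails only if \<open>F\<close> is edgeless with at most \<open>n\<close> vertices, where the
  maximum does not exist; the value is then \<open>Sup {} = 0\<close>.
\<close>

definition ex :: "nat \<Rightarrow> 'a graph \<Rightarrow> nat" where
  "ex n F = Sup ((\<lambda>G. card (edges G)) ` free_graphs n F)"

lemma finite_free_graphs: "finite (free_graphs n F)"
proof (rule finite_subset)
  show "free_graphs n F \<subseteq> (\<lambda>E. \<lparr>verts = {..<n}, edges = E\<rparr>) ` Pow (Pow {..<n})"
  proof
    fix G assume "G \<in> free_graphs n F"
    then have "G = \<lparr>verts = {..<n}, edges = edges G\<rparr>" "edges G \<subseteq> Pow {..<n}"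
      by (auto simp: free_graphs_def simple_graph_def)
    then show "G \<in> (\<lambda>E. \<lparr>verts = {..<n}, edges = E\<rparr>) ` Pow (Pow {..<n})" by blast
  qed
qed simp

lemma ex_eq_Max:
  assumes "free_graphs n F \<noteq> {}"
  shows "ex n F = Max ((\<lambda>G. card (edges G)) ` free_graphs n F)"
  using assms finite_free_graphs[of n F] by (simp add: ex_def cSup_eq_Max)

lemma free_graphs_nonempty:
  assumes "edges F \<noteq> {}"
  shows "free_graphs n F \<noteq> {}"
proof -
  have "\<lparr>verts = {..<n}, edges = {}\<rparr> \<in> free_graphs n F"
    using assms by (auto simp: free_graphs_def simple_graph_def contains_graph_def)
  then show ?thesis by blast
qed

end

theory Submission
  imports Defs
begin

text \<open>
  A blow-up of a tree with parts \<open>I u\<close> is \<open>r\<close>-degenerate only if the neighbouring parts of every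
  part larger than \<open>r\<close> have total size at most \<open>r\<close>: otherwise it contains a complete bipartite
  graph with both sides of size \<open>r + 1\<close>.

  Consider the homomorphisms of the complete bipartite graph with sides of size \<open>r\<close> into a host
  graph on \<open>n\<close> vertices with many edges. Double counting gives more than a large multiple of
  \<open>n ^ r\<close> of them, so for at least half of them both sides have many common neighbours. A cleaning
  argument then yields a nonempty family in which every single vertex of every member can be
  resampled, staying inside the family, in many ways. Resampling vertices one at a time walks
  through the tree: a small part sits inside one side of the current homomorphism, the parts
  around a large part share one side, and the large part goes into the common neighbourhood of
  that side. Every choice can avoid the boundedly many vertices already used.
\<close>

section \<open>Robust families of complete bipartite subgraphs\<close>

definition common_nbrs :: "'v graph \<Rightarrow> nat \<Rightarrow> (nat \<Rightarrow> 'v) \<Rightarrow> 'v set" where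
  "common_nbrs G r f = {x \<in> verts G. \<forall>j<r. {x, f j} \<in> edges G}"

text \<open>Homomorphisms of the complete bipartite graph: \<open>s True\<close> and \<open>s False\<close> list the two sides,
  possibly with repetitions.\<close>

definition bicliques :: "'v graph \<Rightarrow> nat \<Rightarrow> (bool \<Rightarrow> nat \<Rightarrow> 'v) set" where
  "bicliques G r = {s. \<forall>c. s c \<in> {..<r} \<rightarrow>\<^sub>E common_nbrs G r (s (\<not> c))}"

text \<open>Besides replacing one vertex, this encodes a projection: bicliques with equal
  \<open>resample s c i undefined\<close> are those that differ at most at position \<open>i\<close>
  of side \<open>c\<close>.\<close>

definition resample :: "(bool \<Rightarrow> nat \<Rightarrow> 'v) \<Rightarrow> bool \<Rightarrow> nat \<Rightarrow> 'v \<Rightarrow> bool \<Rightarrow> nat \<Rightarrow> 'v" where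
  "resample s c i x = s(c := (s c)(i := x))"

text \<open>The bound on common neighbourhoods makes room for parts larger than \<open>r\<close>.
  The bound on resampling lets any single vertex be moved, inside the family, off a given set of
  fewer than \<open>M\<close> vertices.\<close>

definition robust :: "'v graph \<Rightarrow> nat \<Rightarrow> nat \<Rightarrow> (bool \<Rightarrow> nat \<Rightarrow> 'v) set \<Rightarrow> bool" where
  "robust G r M \<S> \<longleftrightarrow> \<S> \<subseteq> bicliques G r \<and>
     (\<forall>s\<in>\<S>. \<forall>c. M \<le> card (common_nbrs G r (s c)) \<and>
        (\<forall>i<r. M \<le> card {x. resample s c i x \<in> \<S>}))"

lemma side_ext: "s c = t c \<Longrightarrow> s (\<not> c) = t (\<not> c) \<Longrightarrow> s = t" for s t :: "bool \<Rightarrow> 'x"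
  by (cases c) (auto simp: fun_eq_iff all_bool_eq)

lemma common_nbrs_subset: "common_nbrs G r f \<subseteq> verts G"
  by (auto simp: common_nbrs_def)

lemma finite_common_nbrs: "finite (verts G) \<Longrightarrow> finite (common_nbrs G r f)"
  using common_nbrs_subset finite_subset by metis

lemma bicliques_mem_verts: "s \<in> bicliques G r \<Longrightarrow> i < r \<Longrightarrow> s c i \<in> verts G"
  using common_nbrs_subset by (fastforce simp: bicliques_def)

lemma resample_mem_bicliques:
  assumes s: "s \<in> bicliques G r" and i: "i < r" and x: "x \<in> common_nbrs G r (s (\<not> c))"
  shows "resample s c i x \<in> bicliques G r"
proof -
  have sd: "s d \<in> {..<r} \<rightarrow>\<^sub>E common_nbrs G r (s (\<not> d))" for d
    using s by (auto simp: bicliques_def)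
  have "resample s c i x d \<in> {..<r} \<rightarrow>\<^sub>E common_nbrs G r (resample s c i x (\<not> d))" for d
  proof (cases "d = c")
    case True
    then have "resample s c i x d = (s c)(i := x)" "resample s c i x (\<not> d) = s (\<not> c)"
      by (auto simp: resample_def)
    then show ?thesis using sd[of c] x i by (auto simp: PiE_iff extensional_def)
  next
    case False
    then have d: "d = (\<not> c)" by auto
    then have e: "resample s c i x d = s (\<not> c)" "resample s c i x (\<not> d) = (s c)(i := x)"
      by (auto simp: resample_def)
    have "s (\<not> c) k \<in> common_nbrs G r ((s c)(i := x))" if k: "k < r" for k
    proof -
      have "s (\<not> c) k \<in> common_nbrs G r (s c)" using sd[of "\<not> c"] k by auto
      moreover have "{s (\<not> c) k, x} \<in> edges G"
        using x k by (auto simp: common_nbrs_def insert_commute)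
      ultimately show ?thesis by (auto simp: common_nbrs_def)
    qed
    then show ?thesis using sd[of "\<not> c"] unfolding e by (auto simp: PiE_iff)
  qed
  then show ?thesis by (auto simp: bicliques_def)
qed

text \<open>Each common neighbour of the opposite side is an admissible new value at position
  \<open>i\<close>, and distinct values give distinct members of the class.\<close>

lemma card_resample_class:
  assumes s: "s \<in> bicliques G r" and i: "i < r" and "finite (bicliques G r)"
  shows "card (common_nbrs G r (s (\<not> c)))
    \<le> card {t \<in> bicliques G r. resample t c i undefined = resample s c i undefined}"
proof (rule card_inj_on_le)
  show "inj_on (resample s c i) (common_nbrs G r (s (\<not> c)))"
    by (rule inj_onI) (metis fun_upd_same resample_def)
  show "resample s c i ` common_nbrs G r (s (\<not> c))
    \<subseteq> {t \<in> bicliques G r. resample t c i undefined = resample s c i undefined}"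
    using resample_mem_bicliques[OF s i] by (auto simp: resample_def)
qed (use assms in auto)

text \<open>A maximiser of \<open>m |Z|\<close> minus the total size of the classes that \<open>Z\<close> meets cannot gain
  from giving up all of its points in one class.\<close>

lemma exists_dense_in_classes:
  fixes p :: "'k \<Rightarrow> 's \<Rightarrow> 'q"
  assumes S: "finite S" and K: "finite K" and Y: "Y \<subseteq> S"
    and big: "card K * card S < m * card Y"
  shows "\<exists>Z\<subseteq>Y. Z \<noteq> {} \<and>
    (\<forall>s\<in>Z. \<forall>k\<in>K. card {t\<in>S. p k t = p k s} \<le> m * card {t\<in>Z. p k t = p k s})"
proof -
  define h where "h Z = int m * int (card Z) - (\<Sum>k\<in>K. int (card {t\<in>S. p k t \<in> p k ` Z}))" for Z
  have fY: "finite (Pow Y)" using S Y finite_subset by auto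
  obtain Z where Z: "Z \<subseteq> Y" and max: "\<And>Z'. Z' \<subseteq> Y \<Longrightarrow> h Z' \<le> h Z"
  proof -
    have "Max (h ` Pow Y) \<in> h ` Pow Y" using fY by (intro Max_in) auto
    then obtain Z where "Z \<subseteq> Y" "h Z = Max (h ` Pow Y)" by auto
    moreover have "h Z' \<le> Max (h ` Pow Y)" if "Z' \<subseteq> Y" for Z' using fY that by auto
    ultimately show ?thesis using that by metis
  qed
  have fZ: "finite Z" using Z Y S by (meson finite_subset)
  \<comment> \<open>Each term is at most \<open>card S\<close>, so \<open>big\<close> makes
    \<open>h Y\<close> positive. As \<open>h {} = 0\<close>, the maximiser cannot be empty.\<close>
  have "(\<Sum>k\<in>K. int (card {t\<in>S. p k t \<in> p k ` Y})) \<le> (\<Sum>k\<in>K. int (card S))"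
    by (intro sum_mono) (auto intro!: card_mono S)
  then have "0 < h Y" using big by (simp add: h_def flip: of_nat_mult)
  then have "0 < h Z" using max[of Y] by auto
  then have ne: "Z \<noteq> {}" by (auto simp: h_def)
  have "card {t\<in>S. p k t = p k s} \<le> m * card {t\<in>Z. p k t = p k s}" if s: "s \<in> Z" and k: "k \<in> K" for s k
  proof -
    define D where "D = {t\<in>Z. p k t = p k s}"
    define C where "C = {t\<in>S. p k t = p k s}"
    have DZ: "D \<subseteq> Z" by (auto simp: D_def)
    have 1: "int (card (Z - D)) = int (card Z) - int (card D)"
      using DZ fZ by (simp add: card_Diff_subset finite_subset card_mono of_nat_diff)
    have le: "int (card {t\<in>S. p l t \<in> p l ` (Z - D)}) \<le> int (card {t\<in>S. p l t \<in> p l ` Z})" for l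
      using S by (auto intro!: card_mono)
    \<comment> \<open>No point of \<open>Z - D\<close> has the value \<open>p k s\<close>, so giving
      up \<open>D\<close> saves the whole class \<open>C\<close> in term \<open>k\<close>; the other
      terms cannot grow. By maximality the saving is at most the loss
      \<open>m * card D\<close>.\<close>
    have "{t\<in>S. p k t \<in> p k ` (Z - D)} \<subseteq> {t\<in>S. p k t \<in> p k ` Z} - C"
      by (auto simp: D_def C_def)
    then have "card {t\<in>S. p k t \<in> p k ` (Z - D)} \<le> card ({t\<in>S. p k t \<in> p k ` Z} - C)"
      using S by (intro card_mono) auto
    also have "\<dots> = card {t\<in>S. p k t \<in> p k ` Z} - card C"
      using S s by (intro card_Diff_subset) (auto simp: C_def)
    finally have "card {t\<in>S. p k t \<in> p k ` (Z - D)} \<le> card {t\<in>S. p k t \<in> p k ` Z} - card C" .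
    moreover have "card C \<le> card {t\<in>S. p k t \<in> p k ` Z}"
      using S s by (intro card_mono) (auto simp: C_def)
    ultimately have k_le: "int (card {t\<in>S. p k t \<in> p k ` (Z - D)})
        \<le> int (card {t\<in>S. p k t \<in> p k ` Z}) - int (card C)" by linarith
    have "(\<Sum>l\<in>K. int (card {t\<in>S. p l t \<in> p l ` (Z - D)}))
      \<le> (\<Sum>l\<in>K. int (card {t\<in>S. p l t \<in> p l ` Z})) - int (card C)"
      unfolding sum.remove[OF K k] using k_le sum_mono[of "K - {k}", OF le, of "\<lambda>l. l"] by linarith
    moreover have "h (Z - D) \<le> h Z" using Z by (intro max) auto
    ultimately have "int (card C) \<le> int m * int (card D)"
      unfolding h_def 1 by (simp add: algebra_simps)
    then show ?thesis by (simp add: C_def D_def flip: of_nat_mult)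
  qed
  then show ?thesis using Z ne by blast
qed

section \<open>Thin bicliques and the existence of a robust family\<close>

lemma finite_bicliques:
  assumes "finite (verts G)"
  shows "finite (bicliques G r)"
proof (rule inj_on_finite)
  show "inj_on (\<lambda>s. (s True, s False)) (bicliques G r)"
    by (rule inj_onI) (rule side_ext[where c = True], auto)
  show "(\<lambda>s. (s True, s False)) ` bicliques G r
    \<subseteq> ({..<r} \<rightarrow>\<^sub>E verts G) \<times> ({..<r} \<rightarrow>\<^sub>E verts G)"
    by (auto simp: bicliques_def common_nbrs_def)
  show "finite (({..<r} \<rightarrow>\<^sub>E verts G) \<times> ({..<r} \<rightarrow>\<^sub>E verts G))"
    using assms by (auto intro!: finite_PiE)
qed

text \<open>With \<open>s True = f\<close> fixed, the \<open>r\<close> entries of the other side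
  range freely over the common neighbourhood of \<open>f\<close>; the condition on \<open>f\<close>
  itself then follows because adjacency is symmetric.\<close>

lemma card_bicliques:
  assumes "finite (verts G)"
  shows "card (bicliques G r) = (\<Sum>f\<in>{..<r} \<rightarrow>\<^sub>E verts G. card (common_nbrs G r f) ^ r)"
proof -
  let ?P = "SIGMA f:{..<r} \<rightarrow>\<^sub>E verts G. {..<r} \<rightarrow>\<^sub>E common_nbrs G r f"
  have "bij_betw (\<lambda>s. (s True, s False)) (bicliques G r) ?P"
  proof (rule bij_betw_byWitness[where f' = "\<lambda>(f, g) c. if c then f else g"])
    have "(s True, s False) \<in> ?P" if "s \<in> bicliques G r" for s
    proof -
      have "s True \<in> {..<r} \<rightarrow>\<^sub>E common_nbrs G r (s (\<not> True))"
        "s False \<in> {..<r} \<rightarrow>\<^sub>E common_nbrs G r (s (\<not> False))"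
        using that unfolding bicliques_def by blast+
      then show ?thesis using common_nbrs_subset[of G r] by (auto simp: PiE_iff)
    qed
    then show "(\<lambda>s. (s True, s False)) ` bicliques G r \<subseteq> ?P" by blast
    have "(\<lambda>c. if c then f else g) \<in> bicliques G r"
      if f: "f \<in> {..<r} \<rightarrow>\<^sub>E verts G" and g: "g \<in> {..<r} \<rightarrow>\<^sub>E common_nbrs G r f" for f g
    proof -
      have "{f i, g j} \<in> edges G" if "i < r" "j < r" for i j
        using PiE_mem[OF g, of j] that by (simp add: common_nbrs_def insert_commute)
      then have "f \<in> {..<r} \<rightarrow>\<^sub>E common_nbrs G r g"
        using f by (auto simp: common_nbrs_def PiE_iff)
      then show ?thesis using g by (auto simp: bicliques_def)
    qed
    then show "(\<lambda>(f, g) c. if c then f else g) ` ?P \<subseteq> bicliques G r" by auto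
  qed (auto simp: fun_eq_iff)
  then have "card (bicliques G r) = card ?P" by (rule bij_betw_same_card)
  also have "\<dots> = (\<Sum>f\<in>{..<r} \<rightarrow>\<^sub>E verts G. card ({..<r} \<rightarrow>\<^sub>E common_nbrs G r f))"
    using assms by (simp add: finite_PiE finite_common_nbrs)
  finally show ?thesis by (simp add: card_PiE)
qed

text \<open>Side \<open>c\<close> is one of at most \<open>card (verts G) ^ r\<close> tuples, and
  each of the \<open>r\<close> entries opposite has fewer than \<open>L\<close> choices.\<close>

lemma card_thin_bicliques:
  assumes V: "finite (verts G)"
  shows "card {s \<in> bicliques G r. card (common_nbrs G r (s c)) < L} \<le> card (verts G) ^ r * L ^ r"
proof -
  let ?A = "{f \<in> {..<r} \<rightarrow>\<^sub>E verts G. card (common_nbrs G r f) < L}"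
  let ?P = "SIGMA f:?A. {..<r} \<rightarrow>\<^sub>E common_nbrs G r f"
  have fN: "finite (common_nbrs G r f)" for f using V by (rule finite_common_nbrs)
  have fA: "finite ?A" using V by (auto intro!: finite_PiE)
  have "card {s \<in> bicliques G r. card (common_nbrs G r (s c)) < L} \<le> card ?P"
  proof (rule card_inj_on_le)
    show "inj_on (\<lambda>s. (s c, s (\<not> c))) {s \<in> bicliques G r. card (common_nbrs G r (s c)) < L}"
      by (rule inj_onI) (rule side_ext[where c = c], auto)
    have "s c \<in> {..<r} \<rightarrow>\<^sub>E verts G \<and> s (\<not> c) \<in> {..<r} \<rightarrow>\<^sub>E common_nbrs G r (s c)"
      if "s \<in> bicliques G r" for s
    proof -
      have "s c \<in> {..<r} \<rightarrow>\<^sub>E common_nbrs G r (s (\<not> c))"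
        "s (\<not> c) \<in> {..<r} \<rightarrow>\<^sub>E common_nbrs G r (s (\<not> \<not> c))"
        using that unfolding bicliques_def by blast+
      then show ?thesis using common_nbrs_subset[of G r] by (auto simp: PiE_iff)
    qed
    then show "(\<lambda>s. (s c, s (\<not> c))) ` {s \<in> bicliques G r. card (common_nbrs G r (s c)) < L} \<subseteq> ?P"
      by blast
    show "finite ?P" using fA fN by (auto intro!: finite_PiE)
  qed
  also have "card ?P = (\<Sum>f\<in>?A. card (common_nbrs G r f) ^ r)"
    using fA fN by (simp add: finite_PiE card_PiE)
  also have "\<dots> \<le> (\<Sum>f\<in>?A. L ^ r)" by (intro sum_mono power_mono) auto
  also have "\<dots> = card ?A * L ^ r" by simp
  also have "card ?A \<le> card ({..<r} \<rightarrow>\<^sub>E verts G)"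
    using V by (intro card_mono) (auto intro!: finite_PiE)
  finally show ?thesis by (simp add: card_PiE)
qed

text \<open>Fewer than half of the bicliques are thin on some side. Among the rest, a subfamily is
  chosen that keeps a fraction 1/(4r) of every class it meets; these classes have at least
  \<open>L\<close> members, hence \<open>M\<close> of them survive.\<close>

lemma exists_robust:
  assumes V: "finite (verts G)" and r: "r \<ge> 1" and L: "L = 4 * r * M"
    and many: "4 * card (verts G) ^ r * L ^ r < card (bicliques G r)"
  shows "\<exists>\<S>. \<S> \<noteq> {} \<and> robust G r M \<S>"
proof -
  let ?B = "bicliques G r"
  define thin where "thin c = {s \<in> ?B. card (common_nbrs G r (s c)) < L}" for c
  define Y where "Y = ?B - (thin True \<union> thin False)"
  have fB: "finite ?B" by (rule finite_bicliques[OF V])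
  have "card (thin True \<union> thin False) \<le> 2 * (card (verts G) ^ r * L ^ r)"
    using card_thin_bicliques[OF V, of r True L] card_thin_bicliques[OF V, of r False L]
      card_Un_le[of "thin True" "thin False"]
    by (simp add: thin_def)
  moreover have "card ?B - card (thin True \<union> thin False) \<le> card Y"
    unfolding Y_def by (intro diff_card_le_card_Diff) (auto simp: thin_def fB)
  ultimately have "card ?B < 2 * card Y" using many by linarith
  \<comment> \<open>There are 2r positions \<open>(c, i)\<close> to project away, and
    \<open>Y\<close> is more than half of \<open>?B\<close>, so \<open>m = 4 * r\<close> satisfies
    the premise of \<open>exists_dense_in_classes\<close>.\<close>
  then have "card ((UNIV :: bool set) \<times> {..<r}) * card ?B < 4 * r * card Y"
    using r by (simp add: card_cartesian_product)
  then have "\<exists>Z\<subseteq>Y. Z \<noteq> {} \<and> (\<forall>s\<in>Z. \<forall>(c, i)\<in>UNIV \<times> {..<r}.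
      card {t \<in> ?B. resample t c i undefined = resample s c i undefined}
      \<le> 4 * r * card {t \<in> Z. resample t c i undefined = resample s c i undefined})"
    using exists_dense_in_classes[OF fB, of "UNIV \<times> {..<r}" Y "4 * r"
        "\<lambda>(c, i) t. resample t c i undefined"]
    by (simp add: Y_def case_prod_unfold)
  then obtain Z where Z: "Z \<subseteq> Y" "Z \<noteq> {}" and dense: "\<And>s c i. s \<in> Z \<Longrightarrow> i < r \<Longrightarrow>
      card {t \<in> ?B. resample t c i undefined = resample s c i undefined}
      \<le> 4 * r * card {t \<in> Z. resample t c i undefined = resample s c i undefined}"
    by blast
  have ZB: "Z \<subseteq> ?B" using Z by (auto simp: Y_def)
  have thick: "L \<le> card (common_nbrs G r (s c))" if "s \<in> Z" for s c
    using that Z by (cases c) (auto simp: Y_def thin_def)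
  have "M \<le> card {x. resample s c i x \<in> Z}" if s: "s \<in> Z" and i: "i < r" for s c i
  proof -
    let ?D = "{t \<in> Z. resample t c i undefined = resample s c i undefined}"
    have "L \<le> card (common_nbrs G r (s (\<not> c)))" using thick s .
    also have "\<dots> \<le> card {t \<in> ?B. resample t c i undefined = resample s c i undefined}"
      using card_resample_class[OF _ i fB] s ZB by blast
    also have "\<dots> \<le> 4 * r * card ?D" using dense s i .
    finally have "M \<le> card ?D" using r by (simp add: L)
    also have "\<dots> \<le> card {x. resample s c i x \<in> Z}"
    proof (rule card_inj_on_le)
      \<comment> \<open>A member of the class is recovered from its entry at position
        \<open>i\<close> of side \<open>c\<close>, so distinct members count as distinct resampled
        vertices.\<close>
      have eq: "resample s c i (t c i) = t" if "t \<in> ?D" for t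
      proof -
        have "resample s c i (t c i) = resample (resample t c i undefined) c i (t c i)"
          using that by (simp add: resample_def)
        also have "\<dots> = t" by (simp add: resample_def)
        finally show ?thesis .
      qed
      show "inj_on (\<lambda>t. t c i) ?D" using eq by (rule inj_on_inverseI)
      show "(\<lambda>t. t c i) ` ?D \<subseteq> {x. resample s c i x \<in> Z}" using eq by auto
      have "x \<in> verts G" if "resample s c i x \<in> Z" for x
        using bicliques_mem_verts[of "resample s c i x" G r i c] that ZB i
        by (auto simp: resample_def)
      then show "finite {x. resample s c i x \<in> Z}"
        by (intro finite_subset[OF _ V]) auto
    qed
    finally show ?thesis .
  qed
  moreover have "M \<le> L" using r by (simp add: L)
  ultimately have "robust G r M Z"
    using thick ZB unfolding robust_def by (meson le_trans)
  then show ?thesis using Z by blast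
qed

section \<open>Counting complete bipartite subgraphs\<close>

text \<open>A power mean inequality with a lost factor. Pointwise, a^(r-1) (x - a) is at most x^r:
  trivially for x below a, by monotonicity above. Summation of this linear bound costs one of the
  two copies of \<open>a * card I\<close>.\<close>

lemma sum_power_ge:
  fixes x :: "'i \<Rightarrow> real" and a :: real
  assumes "finite I" and x: "\<And>i. i \<in> I \<Longrightarrow> 0 \<le> x i" and a: "0 \<le> a" and r: "r \<ge> 1"
    and sum: "2 * a * card I \<le> sum x I"
  shows "a ^ r * card I \<le> (\<Sum>i\<in>I. x i ^ r)"
proof -
  obtain q where q: "r = Suc q" using r by (cases r) auto
  have "a ^ q * (x i - a) \<le> x i ^ r" if i: "i \<in> I" for i
  proof (cases "a \<le> x i")
    case True
    have "a ^ q * (x i - a) \<le> a ^ q * x i" using a by (intro mult_left_mono) auto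
    also have "\<dots> \<le> x i ^ q * x i" using True a by (intro mult_right_mono power_mono) auto
    finally show ?thesis by (simp add: q mult.commute)
  next
    case False
    then have "a ^ q * (x i - a) \<le> 0" using a by (simp add: mult_nonneg_nonpos)
    also have "0 \<le> x i ^ r" using x i by simp
    finally show ?thesis .
  qed
  then have "(\<Sum>i\<in>I. a ^ q * (x i - a)) \<le> (\<Sum>i\<in>I. x i ^ r)" by (rule sum_mono)
  moreover have "(\<Sum>i\<in>I. a ^ q * (x i - a)) = a ^ q * (sum x I - a * card I)"
    by (simp add: sum_subtractf flip: sum_distrib_left)
  moreover have "a ^ q * (a * card I) \<le> a ^ q * (sum x I - a * card I)"
    using a sum by (intro mult_left_mono) auto
  ultimately show ?thesis by (simp add: q mult.assoc mult.left_commute)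
qed

lemma card_edges_le_sum_nbrs:
  assumes "simple_graph G"
  shows "card (edges G) \<le> (\<Sum>v\<in>verts G. card {x\<in>verts G. {v, x} \<in> edges G})"
proof -
  have V: "finite (verts G)" using assms by (auto simp: simple_graph_def)
  let ?P = "SIGMA v:verts G. {x\<in>verts G. {v, x} \<in> edges G}"
  have "edges G \<subseteq> (\<lambda>(v, x). {v, x}) ` ?P"
  proof
    fix e assume e: "e \<in> edges G"
    then obtain v x where "e = {v, x}" "e \<subseteq> verts G"
      using assms by (auto simp: simple_graph_def card_2_iff)
    then show "e \<in> (\<lambda>(v, x). {v, x}) ` ?P" using e by (intro image_eqI[where x = "(v, x)"]) auto
  qed
  then have "card (edges G) \<le> card ?P" using V by (intro surj_card_le) auto
  then show ?thesis using V by (simp add: card_SigmaI)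
qed

text \<open>Both sides count the pairs of a vertex and an \<open>r\<close>-tuple all of whose
  entries are adjacent to it.\<close>

lemma sum_nbrs_power:
  assumes V: "finite (verts G)"
  shows "(\<Sum>v\<in>verts G. card {x\<in>verts G. {v, x} \<in> edges G} ^ r)
    = (\<Sum>f\<in>{..<r} \<rightarrow>\<^sub>E verts G. card (common_nbrs G r f))"
proof -
  let ?N = "\<lambda>v. {x\<in>verts G. {v, x} \<in> edges G}"
  let ?P = "{..<r} \<rightarrow>\<^sub>E verts G"
  let ?R = "\<lambda>v f. \<forall>j<r. {v, f j} \<in> edges G"
  have fP: "finite ?P" using V by (auto intro!: finite_PiE)
  have "card (?N v) ^ r = card {f\<in>?P. ?R v f}" for v
  proof -
    have "f \<in> ?P \<and> ?R v f \<longleftrightarrow> f \<in> {..<r} \<rightarrow>\<^sub>E ?N v" for f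
      unfolding PiE_iff lessThan_iff mem_Collect_eq by blast
    then have "{f\<in>?P. ?R v f} = {..<r} \<rightarrow>\<^sub>E ?N v" by (rule Collect_eqI[THEN trans]) simp
    then show ?thesis by (simp add: card_PiE)
  qed
  then have "(\<Sum>v\<in>verts G. card (?N v) ^ r) = (\<Sum>v\<in>verts G. card {f\<in>?P. ?R v f})" by simp
  also have "\<dots> = (\<Sum>f\<in>?P. card {v\<in>verts G. ?R v f})"
    unfolding card_eq_sum by (rule sum.swap_restrict[OF V fP])
  finally show ?thesis by (simp add: common_nbrs_def)
qed

text \<open>The power mean bound is applied twice: from degrees to stars with \<open>r\<close>
  leaves, then from common neighbourhoods of tuples to bicliques.\<close>

lemma many_bicliques:
  assumes G: "simple_graph G" and r: "r \<ge> 1" and L: "L \<ge> 1"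
    and e: "20 * real L * real (card (verts G)) powr (2 - 1 / real r) < real (card (edges G))"
  shows "4 * card (verts G) ^ r * L ^ r < card (bicliques G r)"
proof -
  define n where "n = card (verts G)"
  define d where "d v = real (card {x\<in>verts G. {v, x} \<in> edges G})" for v
  let ?P = "{..<r} \<rightarrow>\<^sub>E verts G"
  have V: "finite (verts G)" using G by (auto simp: simple_graph_def)
  have "verts G \<noteq> {}"
  proof
    assume "verts G = {}"
    then have "edges G = {}" using G by (fastforce simp: simple_graph_def)
    then have "real (card (edges G)) = 0" by simp
    moreover have "0 \<le> 20 * real L * real (card (verts G)) powr (2 - 1 / real r)" by simp
    ultimately show False using e by linarith
  qed
  then have n: "n > 0" using V by (simp add: n_def card_gt_0_iff)
  \<comment> \<open>Half of the lower bound on the average of \<open>d\<close>; the exponent is the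
    one for which \<open>a ^ r * n\<close> becomes a constant times n^r, that is, a constant per
    \<open>r\<close>-tuple.\<close>
  define a where "a = 10 * real L * real n powr (1 - 1 / real r)"
  have "2 * a * n = 20 * real L * real n powr (2 - 1 / real r)"
  proof -
    have "real n powr (2 - 1 / real r) = real n powr (1 - 1 / real r) * real n powr 1"
      using n by (subst powr_add[symmetric]) simp
    then show ?thesis using n by (simp add: a_def)
  qed
  also have "\<dots> \<le> real (card (edges G))" using e by (simp add: n_def)
  also have "\<dots> \<le> sum d (verts G)"
    using card_edges_le_sum_nbrs[OF G] unfolding d_def of_nat_sum[symmetric] of_nat_le_iff .
  finally have "a ^ r * n \<le> (\<Sum>v\<in>verts G. d v ^ r)"
    unfolding n_def using V r by (intro sum_power_ge) (auto simp: d_def a_def)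
  also have "\<dots> = (\<Sum>f\<in>?P. real (card (common_nbrs G r f)))"
    using arg_cong[OF sum_nbrs_power[OF V, of r], of real] by (simp add: d_def)
  also have "a ^ r * n = (10 * real L) ^ r * real n ^ r"
  proof -
    have "(1 - 1 / real r) * real r = real r - 1" using r by (simp add: left_diff_distrib)
    then have "(real n powr (1 - 1 / real r)) ^ r * n = real n powr (real r - 1) * real n powr 1"
      using n by (simp add: powr_powr flip: powr_realpow)
    also have "\<dots> = real n ^ r" unfolding powr_add[symmetric] using n by (simp add: powr_realpow)
    finally show ?thesis by (simp add: a_def power_mult_distrib mult.assoc)
  qed
  finally have 1: "(10 * real L) ^ r * real n ^ r \<le> (\<Sum>f\<in>?P. real (card (common_nbrs G r f)))" .
  have cP: "card ?P = n ^ r" by (simp add: card_PiE n_def)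
  \<comment> \<open>The average common neighbourhood has size at least 10 L, so the second
    application runs with 5 L. The final gap is 5^r against 4.\<close>
  have "10 * real L \<le> (10 * real L) ^ r" using L r by (intro self_le_power) auto
  then have "2 * (5 * real L) * real (card ?P) \<le> (10 * real L) ^ r * real n ^ r"
    unfolding cP by (simp add: mult_right_mono)
  then have "(5 * real L) ^ r * card ?P \<le> (\<Sum>f\<in>?P. real (card (common_nbrs G r f)) ^ r)"
    using V r 1 by (intro sum_power_ge) (auto intro!: finite_PiE)
  also have "\<dots> = real (card (bicliques G r))" by (simp add: card_bicliques[OF V])
  finally have 2: "(5 * real L) ^ r * real n ^ r \<le> real (card (bicliques G r))" by (simp add: cP)
  have "(5::real) \<le> 5 ^ r" using r by (intro self_le_power) auto
  then have "4 * (real L ^ r * real n ^ r) < 5 ^ r * (real L ^ r * real n ^ r)"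
    using L n by (intro mult_strict_right_mono) auto
  then have "4 * real n ^ r * real L ^ r < real (card (bicliques G r))"
    using 2 by (simp add: power_mult_distrib mult_ac)
  then have "real (4 * n ^ r * L ^ r) < real (card (bicliques G r))" by simp
  then show ?thesis unfolding of_nat_less_iff n_def .
qed

section \<open>Choosing fresh vertices inside a robust family\<close>

text \<open>The positions in \<open>J\<close> are treated one by one. At each of them fewer than
  \<open>M\<close> vertices are forbidden, namely \<open>U\<close> and the values just chosen, while
  at least \<open>M\<close> keep the biclique in the family.\<close>

lemma robust_resample:
  assumes rob: "robust G r M \<S>" and s: "s \<in> \<S>" and J: "J \<subseteq> {..<r}"
    and U: "finite U" "card U + card J \<le> M"
  shows "\<exists>t\<in>\<S>. t (\<not> c) = s (\<not> c) \<and> (\<forall>j. j \<notin> J \<longrightarrow> t c j = s c j) \<and>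
    inj_on (t c) J \<and> t c ` J \<inter> U = {}"
proof -
  have "finite J" using J finite_subset by blast
  then show ?thesis using J U(2)
  proof (induction J rule: finite_induct)
    case empty
    then show ?case using s by auto
  next
    case (insert j J)
    then obtain t where t: "t \<in> \<S>" "t (\<not> c) = s (\<not> c)" "\<And>i. i \<notin> J \<Longrightarrow> t c i = s c i"
      "inj_on (t c) J" "t c ` J \<inter> U = {}" by auto
    let ?X = "{x. resample t c j x \<in> \<S>}"
    let ?W = "U \<union> t c ` J"
    have "card ?W \<le> card U + card J"
      using card_Un_le[of U "t c ` J"] card_image_le[OF insert.hyps(1), of "t c"] by linarith
    also have "\<dots> < M" using insert by simp
    also have "M \<le> card ?X" using rob t(1) insert.prems by (auto simp: robust_def)
    finally have "\<not> ?X \<subseteq> ?W"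
      using card_mono[of ?W ?X] U(1) insert.hyps(1) by auto
    then obtain x where x: "resample t c j x \<in> \<S>" "x \<notin> ?W" by auto
    have new: "resample t c j x c = (t c)(j := x)" "resample t c j x (\<not> c) = t (\<not> c)"
      by (auto simp: resample_def)
    have img: "((t c)(j := x)) ` J = t c ` J" using insert.hyps(2) by auto
    have "inj_on ((t c)(j := x)) (insert j J)"
      using t(4) x(2) insert.hyps(2) img by (auto simp: inj_on_def)
    moreover have "((t c)(j := x)) ` insert j J \<inter> U = {}"
      using img t(5) x(2) by auto
    moreover have "\<forall>i. i \<notin> insert j J \<longrightarrow> ((t c)(j := x)) i = s c i" using t(3) by auto
    ultimately show ?case using x(1) new t(2) by metis
  qed
qed

text \<open>One step of the embedding: \<open>P\<close> is already placed on side \<open>c\<close>,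
  \<open>Q\<close> is to join it there, \<open>R\<close> has to be adjacent to both, and
  \<open>U\<close> is occupied. Side \<open>c\<close> is freshly resampled away from
  \<open>P\<close>; then a small \<open>R\<close> goes onto the resampled opposite side, and a large
  \<open>R\<close> anywhere in the common neighbourhood.\<close>

lemma robust_extend:
  assumes rob: "robust G r M \<S>" and s: "s \<in> \<S>" and P: "P \<subseteq> s c ` {..<r}"
    and Q: "finite Q" "card P + card Q \<le> r" and R: "finite R" and QR: "Q \<inter> R = {}"
    and U: "finite U" "P \<subseteq> U" and M: "card U + card Q + card R + r \<le> M"
  shows "\<exists>t\<in>\<S>. \<exists>g. inj_on g (Q \<union> R) \<and> g ` (Q \<union> R) \<inter> U = {} \<and>
    P \<union> g ` Q \<subseteq> t c ` {..<r} \<and> g ` R \<subseteq> common_nbrs G r (t c) \<and>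
    (card R \<le> r \<longrightarrow> g ` R \<subseteq> t (\<not> c) ` {..<r})"
proof -
  \<comment> \<open>One position is kept for each vertex of \<open>P\<close>. Positions that merely
    repeat such a vertex are released, so exactly \<open>r - card P\<close> become free for
    \<open>Q\<close>.\<close>
  obtain K where K: "K \<subseteq> {..<r}" "inj_on (s c) K" "P = s c ` K"
    using P unfolding subset_image_inj by blast
  have fK: "finite K" using K(1) finite_subset by blast
  let ?J = "{..<r} - K"
  have "card ?J = r - card K" using K(1) fK by (simp add: card_Diff_subset)
  also have "card K = card P" using K by (simp add: card_image)
  finally have cJ: "card Q \<le> card ?J" "card ?J \<le> r" using Q by auto
  have "card U + card ?J \<le> M" using M cJ by linarith
  from robust_resample[OF rob s _ U(1) this, of c]
  obtain t1 where t1: "t1 \<in> \<S>" "\<And>j. j \<notin> ?J \<Longrightarrow> t1 c j = s c j" "inj_on (t1 c) ?J"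
    "t1 c ` ?J \<inter> U = {}" by auto
  obtain q where q: "q ` Q \<subseteq> ?J" "inj_on q Q"
    using card_le_inj[OF Q(1) _ cJ(1)] by auto
  define g1 where "g1 = t1 c \<circ> q"
  have g1: "inj_on g1 Q" "g1 ` Q \<subseteq> t1 c ` ?J"
    using q t1(3) unfolding g1_def by (auto intro!: comp_inj_on intro: inj_on_subset)
  have "P = t1 c ` K" using K t1(2) by auto
  then have Pt: "P \<subseteq> t1 c ` {..<r}" using K(1) by auto
  let ?U = "U \<union> g1 ` Q"
  have fU: "finite ?U" using U Q by auto
  have cU: "card ?U \<le> card U + card Q"
    using card_Un_le[of U "g1 ` Q"] card_image_le[OF Q(1), of g1] by linarith
  obtain t2 g2 where t2: "t2 \<in> \<S>" "t2 c = t1 c" and g2: "inj_on g2 R"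
    "g2 ` R \<subseteq> common_nbrs G r (t2 c)" "g2 ` R \<inter> ?U = {}"
    "card R \<le> r \<Longrightarrow> g2 ` R \<subseteq> t2 (\<not> c) ` {..<r}"
  proof (cases "card R \<le> r")
    case True
    have "card ?U + card {..<r} \<le> M" using M cU by simp
    from robust_resample[OF rob t1(1) _ fU this, of "\<not> c"]
    obtain t2 where t2: "t2 \<in> \<S>" "t2 c = t1 c" "inj_on (t2 (\<not> c)) {..<r}"
      "t2 (\<not> c) ` {..<r} \<inter> ?U = {}" by auto
    obtain p where p: "p ` R \<subseteq> {..<r}" "inj_on p R"
      using card_le_inj[OF R, of "{..<r}"] True by auto
    let ?g = "t2 (\<not> c) \<circ> p"
    have "t2 \<in> bicliques G r" using rob t2(1) by (auto simp: robust_def)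
    then have "t2 (\<not> c) \<in> {..<r} \<rightarrow>\<^sub>E common_nbrs G r (t2 (\<not> \<not> c))"
      unfolding bicliques_def by blast
    then have "t2 (\<not> c) ` {..<r} \<subseteq> common_nbrs G r (t2 c)" by auto
    moreover have "?g ` R \<subseteq> t2 (\<not> c) ` {..<r}" using p by auto
    moreover have "inj_on ?g R" using p t2(3) by (auto intro!: comp_inj_on intro: inj_on_subset)
    ultimately show ?thesis using t2 by (intro that[of t2 ?g]) blast+
  next
    case False
    let ?X = "common_nbrs G r (t1 c)"
    have MX: "M \<le> card ?X" using rob t1(1) by (auto simp: robust_def)
    have "card R \<le> card ?X - card ?U" using M cU MX by linarith
    also have "\<dots> \<le> card (?X - ?U)" using fU by (rule diff_card_le_card_Diff)
    finally have le: "card R \<le> card (?X - ?U)" .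
    \<comment> \<open>An infinite set has \<open>card\<close> 0, so \<open>le\<close> forces
      finiteness as soon as \<open>R\<close> is nonempty.\<close>
    have "finite (?X - ?U)" if "R \<noteq> {}"
      using le that R by (metis card_0_eq card.infinite le_zero_eq)
    then obtain g where g: "g ` R \<subseteq> ?X - ?U" "inj_on g R"
      using card_le_inj[OF R _ le] by (cases "R = {}") auto
    show ?thesis using g t1 False by (intro that[of t1 g]) auto
  qed
  define g where "g x = (if x \<in> Q then g1 x else g2 x)" for x
  have gQ: "g ` Q = g1 ` Q" and gR: "g ` R = g2 ` R" using QR by (auto simp: g_def)
  have "inj_on g Q" using g1(1) by (simp add: g_def cong: inj_on_cong)
  moreover have "inj_on g R"
  proof -
    have "g x = g2 x" if "x \<in> R" for x using that QR by (auto simp: g_def)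
    then show ?thesis using g2(1) by (simp cong: inj_on_cong)
  qed
  moreover have "g ` Q \<inter> g ` R = {}" unfolding gQ gR using g2(3) by blast
  ultimately have "inj_on g (Q \<union> R)" by (auto simp: inj_on_Un)
  moreover have "g ` (Q \<union> R) \<inter> U = {}"
    unfolding image_Un gQ gR using g1(2) t1(4) g2(3) by blast
  moreover have "P \<union> g ` Q \<subseteq> t2 c ` {..<r}"
    unfolding gQ t2(2) using Pt g1(2) by blast
  ultimately show ?thesis using t2(1) g2 gR by metis
qed

section \<open>Trees\<close>

text \<open>Paths are distinct vertex lists, so that prepending one vertex adjacent to both ends of
  such a list yields a list fit for \<open>is_cycle\<close>.\<close>

definition path_within :: "'b graph \<Rightarrow> 'b set \<Rightarrow> 'b \<Rightarrow> 'b \<Rightarrow> 'b list \<Rightarrow> bool" where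
  "path_within T S x y p \<longleftrightarrow> p \<noteq> [] \<and> hd p = x \<and> last p = y \<and> set p \<subseteq> S \<and>
     distinct p \<and> successively (\<lambda>a b. {a, b} \<in> edges T) p"

definition linked :: "'b graph \<Rightarrow> 'b set \<Rightarrow> bool" where
  "linked T S \<longleftrightarrow> (\<forall>x\<in>S. \<forall>y\<in>S. \<exists>p. path_within T S x y p)"

definition nbrs :: "'b graph \<Rightarrow> 'b \<Rightarrow> 'b set" where
  "nbrs T u = {v. {u, v} \<in> edges T}"

lemma nbrs_sym: "v \<in> nbrs T u \<Longrightarrow> u \<in> nbrs T v"
  by (simp add: nbrs_def insert_commute)

lemma nbrs_subset: "simple_graph T \<Longrightarrow> nbrs T u \<subseteq> verts T"
  by (auto simp: nbrs_def simple_graph_def)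

lemma nbrs_irrefl: "simple_graph T \<Longrightarrow> u \<notin> nbrs T u"
  by (auto simp: nbrs_def simple_graph_def)

lemma linked_insert:
  assumes S: "linked T S" and v: "S = {} \<or> (\<exists>v\<in>S. v \<in> nbrs T u)"
  shows "linked T (insert u S)"
proof (cases "u \<in> S")
  case True
  then show ?thesis using S by (simp add: insert_absorb)
next
  case u: False
  have "path_within T (insert u S) u u [u]" by (simp add: path_within_def)
  moreover have "\<exists>p. path_within T (insert u S) u y p" "\<exists>p. path_within T (insert u S) y u p"
    if y: "y \<in> S" for y
  proof -
    obtain v where v: "v \<in> S" "{u, v} \<in> edges T" using assms(2) y by (auto simp: nbrs_def)
    obtain p where "path_within T S v y p" using S v(1) y unfolding linked_def by blast
    then have "path_within T (insert u S) u y (u # p)"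
      using u v(2) by (auto simp: path_within_def successively_Cons)
    then show "\<exists>p. path_within T (insert u S) u y p" by blast
    obtain p where "path_within T S y v p" using S v(1) y unfolding linked_def by blast
    then have "path_within T (insert u S) y u (p @ [u])"
      using u v(2) by (auto simp: path_within_def successively_append_iff insert_commute)
    then show "\<exists>p. path_within T (insert u S) y u p" by blast
  qed
  moreover have "\<exists>p. path_within T (insert u S) x y p" if xy: "x \<in> S" "y \<in> S" for x y
  proof -
    obtain p where "path_within T S x y p" using S xy unfolding linked_def by blast
    then have "path_within T (insert u S) x y p" by (auto simp: path_within_def)
    then show ?thesis by blast
  qed
  ultimately show ?thesis unfolding linked_def by blast
qed

text \<open>A path inside \<open>S\<close> between two different neighbours of \<open>u\<close> has
  at least two vertices and closes up through \<open>u\<close> to a cycle. Hence a new vertex sees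
  at most one vertex of the region embedded so far.\<close>

lemma tree_unique_nbr:
  assumes T: "tree T" and S: "linked T S" and u: "u \<notin> S"
    and vw: "v \<in> S" "w \<in> S" "v \<in> nbrs T u" "w \<in> nbrs T u"
  shows "v = w"
proof (rule ccontr)
  assume ne: "v \<noteq> w"
  obtain p where "path_within T S v w p" using S vw(1,2) unfolding linked_def by blast
  then have p: "p \<noteq> []" "hd p = v" "last p = w" "set p \<subseteq> S" "distinct p"
    "successively (\<lambda>a b. {a, b} \<in> edges T) p"
    unfolding path_within_def by blast+
  have "length p \<noteq> 1" using p ne by (auto simp: length_Suc_conv)
  then have len: "length p \<ge> 2" using p(1) by (cases p) (auto simp: Suc_le_eq)
  have "{(u # p) ! i, (u # p) ! (Suc i mod length (u # p))} \<in> edges T" if i: "i < length (u # p)" for i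
  proof -
    consider "i = 0" | "0 < i" "i < length p" | "i = length p" "0 < i"
      using i p(1) by (cases i) (auto simp: less_Suc_eq)
    then show ?thesis
    proof cases
      case 1
      then show ?thesis using vw(3) p len by (auto simp: nbrs_def hd_conv_nth)
    next
      case 2
      then show ?thesis using p(6) by (cases i) (auto simp: successively_conv_nth)
    next
      case 3
      then have "(u # p) ! i = w" using p by (auto simp: last_conv_nth nth_Cons')
      then show ?thesis using 3 vw(4) by (simp add: nbrs_def insert_commute)
    qed
  qed
  then have "is_cycle T (u # p)"
    using len p u unfolding is_cycle_def by auto
  then show False using T by (auto simp: tree_def)
qed

text \<open>Without such an edge, membership in \<open>S\<close> would spread along every walk that
  starts in \<open>S\<close>. This supplies the next vertex to embed.\<close>

lemma connected_crossing_edge: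
  assumes T: "simple_graph T" "connected_graph T" and S: "S \<subseteq> verts T" "S \<noteq> {}" "S \<noteq> verts T"
  shows "\<exists>u\<in>verts T - S. \<exists>v\<in>S. v \<in> nbrs T u"
proof (rule ccontr)
  assume no: "\<not> ?thesis"
  obtain x y where xy: "x \<in> S" "y \<in> verts T" "y \<notin> S" using S by blast
  then have "(x, y) \<in> (adjacency T)\<^sup>*" using T(2) S(1) by (auto simp: connected_graph_def)
  then have "y \<in> S"
  proof (induction rule: rtrancl_induct)
    case (step a b)
    then have "b \<in> nbrs T a" by (simp add: adjacency_def nbrs_def)
    moreover have "b \<in> verts T" using calculation nbrs_subset[OF T(1)] by blast
    ultimately show ?case using no step.IH nbrs_sym by fast
  qed (rule xy)
  then show False using xy by simp
qed

section \<open>Embedding the blow-up\<close>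

text \<open>The assumption \<open>big\<close> carries everything that degeneracy contributes to the
  embedding.\<close>

locale blow_up_host =
  fixes G :: "'v graph" and r M :: nat and \<S> :: "(bool \<Rightarrow> nat \<Rightarrow> 'v) set"
    and T :: "'b graph" and I :: "'b \<Rightarrow> 'a set"
  assumes tree: "tree T" and robust: "robust G r M \<S>" and nonempty: "\<S> \<noteq> {}"
    and fin: "\<And>u. u \<in> verts T \<Longrightarrow> finite (I u)" and disj: "disjoint_family_on I (verts T)"
    and big: "\<And>u. u \<in> verts T \<Longrightarrow> r < card (I u) \<Longrightarrow> card (\<Union>(I ` nbrs T u)) \<le> r"
    and M: "3 * card (\<Union>(I ` verts T)) + r \<le> M"
begin

text \<open>The invariant of the walk through the tree. A small part remembers a member of
  \<open>\<S>\<close> with a side containing it, possibly a different member for each part, from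
  which a neighbour can be attached. A large part has no such side, so all its neighbours must
  already be present.\<close>

definition embeds :: "'b set \<Rightarrow> ('a \<Rightarrow> 'v) \<Rightarrow> bool" where
  "embeds S \<phi> \<longleftrightarrow> S \<subseteq> verts T \<and> linked T S \<and> (\<forall>u\<in>S. r < card (I u) \<longrightarrow> nbrs T u \<subseteq> S) \<and>
     inj_on \<phi> (\<Union>(I ` S)) \<and> \<phi> ` \<Union>(I ` S) \<subseteq> verts G \<and>
     (\<forall>u\<in>S. \<forall>v\<in>S. v \<in> nbrs T u \<longrightarrow> (\<forall>x\<in>I u. \<forall>y\<in>I v. {\<phi> x, \<phi> y} \<in> edges G)) \<and>
     (\<forall>u\<in>S. card (I u) \<le> r \<longrightarrow> (\<exists>s\<in>\<S>. \<exists>c. \<phi> ` I u \<subseteq> s c ` {..<r}))"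

lemma tree_basics: "simple_graph T" "connected_graph T" "finite (verts T)"
  using tree unfolding tree_def simple_graph_def by blast+

lemma fin_Union: "A \<subseteq> verts T \<Longrightarrow> finite (\<Union>(I ` A))"
  by (meson tree_basics(3) fin finite_UN_I finite_subset subsetD)

lemma disj_Union:
  assumes "A \<subseteq> verts T" "B \<subseteq> verts T" "A \<inter> B = {}"
  shows "\<Union>(I ` A) \<inter> \<Union>(I ` B) = {}"
proof -
  have "I a \<inter> I b = {}" if "a \<in> A" "b \<in> B" for a b
    using that assms by (intro disjoint_family_onD[OF disj]) auto
  then show ?thesis by blast
qed

text \<open>A vertex with a large part is added together with all of its neighbours, whose parts must
  share one side of a biclique.\<close>

lemma embeds_extend:
  assumes emb: "embeds S \<phi>" and u: "u \<in> verts T" "u \<notin> S"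
    and att: "S = {} \<or> (\<exists>v\<in>S. v \<in> nbrs T u)"
  shows "\<exists>S' \<phi>'. insert u S \<subseteq> S' \<and> embeds S' \<phi>'"
proof -
  \<comment> \<open>\<open>N\<close> holds the neighbours already embedded, \<open>W\<close> those
    that must enter together with \<open>u\<close>; the latter exist only when \<open>I u\<close> is
    large.\<close>
  define N where "N = nbrs T u \<inter> S"
  define W where "W = (if r < card (I u) then nbrs T u - S else {})"
  define Q where "Q = \<Union>(I ` W)"
  define P where "P = \<phi> ` \<Union>(I ` N)"
  define U where "U = \<phi> ` \<Union>(I ` S)"
  note sub = nbrs_subset[OF tree_basics(1)] and irr = nbrs_irrefl[OF tree_basics(1)]
  have S: "S \<subseteq> verts T" "linked T S" "\<forall>v\<in>S. r < card (I v) \<longrightarrow> nbrs T v \<subseteq> S"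
    and inj: "inj_on \<phi> (\<Union>(I ` S))" and im: "\<phi> ` \<Union>(I ` S) \<subseteq> verts G"
    and edge: "\<forall>u\<in>S. \<forall>v\<in>S. v \<in> nbrs T u \<longrightarrow> (\<forall>x\<in>I u. \<forall>y\<in>I v. {\<phi> x, \<phi> y} \<in> edges G)"
    and state: "\<forall>u\<in>S. card (I u) \<le> r \<longrightarrow> (\<exists>s\<in>\<S>. \<exists>c. \<phi> ` I u \<subseteq> s c ` {..<r})"
    using emb unfolding embeds_def by - (elim conjE; assumption)+
  have W: "W \<subseteq> verts T" "W \<inter> S = {}" "W \<subseteq> nbrs T u" "u \<notin> W"
    using sub[of u] irr[of u] by (auto simp: W_def)
  have fS: "finite (\<Union>(I ` S))" and fQ: "finite Q" and fR: "finite (I u)"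
    using fin_Union S W fin u by (auto simp: Q_def)
  have QR: "Q \<inter> I u = {}" and SQR: "\<Union>(I ` S) \<inter> (Q \<union> I u) = {}"
    using disj_Union[of W "{u}"] disj_Union[of W S] disj_Union[of S "{u}"] S W u by (auto simp: Q_def)
  \<comment> \<open>The only embedded neighbour \<open>v\<close> has a small part, since a large one
    would have brought \<open>u\<close> into \<open>S\<close>. Its remembered biclique starts the
    step; if \<open>S\<close> is empty, any member of \<open>\<S>\<close> does.\<close>
  have "\<exists>s\<in>\<S>. \<exists>c. P \<subseteq> s c ` {..<r}"
  proof (cases "S = {}")
    case True
    then show ?thesis using nonempty by (auto simp: P_def N_def)
  next
    case False
    then obtain v where v: "v \<in> S" "v \<in> nbrs T u" using att by blast
    have "w = v" if "w \<in> N" for w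
      using that v tree_unique_nbr[OF tree S(2) u(2), of w v] unfolding N_def by blast
    then have "N = {v}" using v unfolding N_def by blast
    moreover have "card (I v) \<le> r"
    proof (rule ccontr)
      assume "\<not> card (I v) \<le> r"
      then show False using S(3) v u(2) nbrs_sym[of v T u] by (metis not_le_imp_less subsetD)
    qed
    ultimately show ?thesis using state v(1) by (simp add: P_def)
  qed
  then obtain s c where s: "s \<in> \<S>" "P \<subseteq> s c ` {..<r}" by blast
  \<comment> \<open>For a large \<open>I u\<close>, the sets behind \<open>P\<close> and
    \<open>Q\<close> make up all neighbouring parts, so \<open>big\<close> applies. Otherwise
    \<open>Q\<close> is empty and \<open>P\<close> lies among \<open>r\<close> entries.\<close>
  have PQ: "card P + card Q \<le> r"
  proof (cases "r < card (I u)")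
    case True
    have NW: "N \<subseteq> verts T" "N \<inter> W = {}" "N \<union> W = nbrs T u"
      using S(1) True by (auto simp: N_def W_def)
    have "card P \<le> card (\<Union>(I ` N))"
      unfolding P_def using fin_Union[OF NW(1)] by (rule card_image_le)
    moreover have "card (\<Union>(I ` N)) + card Q = card (\<Union>(I ` N) \<union> Q)"
      unfolding Q_def using fin_Union NW W(1) disj_Union by (intro card_Un_disjoint[symmetric]) auto
    moreover have "\<Union>(I ` N) \<union> Q = \<Union>(I ` nbrs T u)" unfolding Q_def NW(3)[symmetric] by blast
    ultimately show ?thesis using big[OF u(1) True] by simp
  next
    case False
    have "card P \<le> card {..<r}" using s(2) by (intro surj_card_le) auto
    then show ?thesis using False by (simp add: Q_def W_def)
  qed
  \<comment> \<open>The factor 3 pays for the occupied vertices, the new neighbouring parts and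
    \<open>I u\<close>; the extra \<open>r\<close> pays for resampling a full side.\<close>
  have bound: "card U + card Q + card (I u) + r \<le> M"
  proof -
    have le: "card A \<le> card (\<Union>(I ` verts T))" if "A \<subseteq> \<Union>(I ` verts T)" for A
      using fin_Union that by (intro card_mono) auto
    have "card U \<le> card (\<Union>(I ` S))" unfolding U_def using fS by (rule card_image_le)
    also have "\<dots> \<le> card (\<Union>(I ` verts T))" using S(1) by (intro le) blast
    moreover have "card Q \<le> card (\<Union>(I ` verts T))" using W(1) by (intro le) (auto simp: Q_def)
    moreover have "card (I u) \<le> card (\<Union>(I ` verts T))" using u(1) by (intro le) blast
    ultimately show ?thesis using M by linarith
  qed
  have U: "finite U" "P \<subseteq> U" using fS by (auto simp: U_def P_def N_def)
  obtain t g where t: "t \<in> \<S>" and g: "inj_on g (Q \<union> I u)" "g ` (Q \<union> I u) \<inter> U = {}"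
      "P \<union> g ` Q \<subseteq> t c ` {..<r}" "g ` I u \<subseteq> common_nbrs G r (t c)"
      "card (I u) \<le> r \<longrightarrow> g ` I u \<subseteq> t (\<not> c) ` {..<r}"
    using robust_extend[OF robust s fQ PQ fR QR U bound]
    by - (elim bexE exE conjE, rule that; assumption)
  have tc: "t c ` {..<r} \<subseteq> verts G"
    using robust t bicliques_mem_verts[of t G r _ c] by (auto simp: robust_def)
  define \<phi>' where "\<phi>' x = (if x \<in> Q \<union> I u then g x else \<phi> x)" for x
  define S' where "S' = insert u (S \<union> W)"
  have US': "\<Union>(I ` S') = \<Union>(I ` S) \<union> (Q \<union> I u)" by (auto simp: S'_def Q_def)
  have old: "\<phi>' x = \<phi> x" if "x \<in> \<Union>(I ` S)" for x
    using SQR that unfolding \<phi>'_def by auto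
  have new: "\<phi>' x = g x" if "x \<in> Q \<union> I u" for x using that unfolding \<phi>'_def by simp
  have old_im: "\<phi>' ` A = \<phi> ` A" if "A \<subseteq> \<Union>(I ` S)" for A
    using old that by (intro image_cong refl) blast
  have new_im: "\<phi>' ` A = g ` A" if "A \<subseteq> Q \<union> I u" for A
    using new that by (intro image_cong refl) blast
  have inj': "inj_on \<phi>' (\<Union>(I ` S'))"
  proof -
    have "inj_on \<phi>' (\<Union>(I ` S))" using inj old inj_on_cong[of "\<Union>(I ` S)" \<phi>' \<phi>] by blast
    moreover have "inj_on \<phi>' (Q \<union> I u)" using g(1) new inj_on_cong[of "Q \<union> I u" \<phi>' g] by blast
    moreover have "\<phi>' ` \<Union>(I ` S) \<inter> \<phi>' ` (Q \<union> I u) = {}"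
      using g(2) unfolding old_im[OF order_refl] new_im[OF order_refl] U_def by blast
    ultimately show ?thesis unfolding US' inj_on_Un by blast
  qed
  have im': "\<phi>' ` \<Union>(I ` S') \<subseteq> verts G"
  proof -
    have "\<phi>' ` \<Union>(I ` S') = \<phi> ` \<Union>(I ` S) \<union> g ` Q \<union> g ` I u"
      unfolding US' image_Un[of \<phi>'] old_im[OF order_refl] by (simp add: new_im Un_assoc)
    moreover have "g ` Q \<subseteq> verts G" using g(3) tc by (meson Un_subset_iff order_trans)
    moreover have "g ` I u \<subseteq> verts G" using g(4) common_nbrs_subset by (rule order_trans)
    ultimately show ?thesis using im by simp
  qed
  have SV: "S' \<subseteq> verts T" using S(1) u(1) W(1) by (auto simp: S'_def)
  have lu: "linked T (insert u S)" using linked_insert[OF S(2) att] .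
  \<comment> \<open>Stated for arbitrary subsets of \<open>W\<close>, because the exclusion of edges
    at \<open>W\<close> below needs linked sets that omit one vertex of \<open>W\<close>.\<close>
  have lW: "linked T (W' \<union> insert u S)" if "W' \<subseteq> W" for W'
  proof -
    have "W' \<subseteq> verts T" using that W(1) by (rule order_trans)
    then have "finite W'" using tree_basics(3) by (rule finite_subset)
    then show ?thesis using that
    proof (induction W' rule: finite_induct)
      case empty
      then show ?case using lu by simp
    next
      case (insert w W')
      then have "u \<in> nbrs T w" using W(3) nbrs_sym[of w T u] by blast
      then show ?case using insert linked_insert[of T "W' \<union> insert u S" w]
        by (auto simp: insert_commute)
    qed
  qed
  have linked': "linked T S'" using lW[of W] by (simp add: S'_def Un_commute)
  have closed': "nbrs T v \<subseteq> S'" if v: "v \<in> S'" "r < card (I v)" for v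
  proof -
    \<comment> \<open>Parts indexed by \<open>W\<close> lie in a union of size at most
      \<open>r\<close>, so they are small and require no further neighbours: the closure condition
      does not cascade.\<close>
    have "card (I v) \<le> r" if w: "v \<in> W"
    proof -
      have "r < card (I u)" using w by (auto simp: W_def split: if_splits)
      then have "card (\<Union>(I ` nbrs T u)) \<le> r" using big u(1) by blast
      moreover have "card (I v) \<le> card (\<Union>(I ` nbrs T u))"
        using w W(3) fin_Union[OF sub] by (intro card_mono) auto
      ultimately show ?thesis by simp
    qed
    then consider "v \<in> S" | "v = u" using v by (auto simp: S'_def)
    then show ?thesis
    proof cases
      case 1
      then show ?thesis using S(3) v(2) by (auto simp: S'_def)
    next
      case 2
      then show ?thesis using v(2) by (auto simp: S'_def W_def)
    qed
  qed
  have state': "\<exists>s\<in>\<S>. \<exists>c. \<phi>' ` I v \<subseteq> s c ` {..<r}" if v: "v \<in> S'" "card (I v) \<le> r" for v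
  proof -
    consider "v \<in> S" | "v = u" | "v \<in> W" using v by (auto simp: S'_def)
    then show ?thesis
    proof cases
      case 1
      then have "\<phi>' ` I v = \<phi> ` I v" by (intro old_im) auto
      then show ?thesis using state 1 v(2) by simp
    next
      case 2
      then have "\<phi>' ` I v = g ` I u" by (simp add: new_im)
      then show ?thesis using g(5) 2 v(2) t by metis
    next
      case 3
      then have "I v \<subseteq> Q" by (auto simp: Q_def)
      then have "\<phi>' ` I v = g ` I v" "g ` I v \<subseteq> g ` Q" by (auto intro!: new_im)
      then have "\<phi>' ` I v \<subseteq> t c ` {..<r}" using g(3) by blast
      then show ?thesis using t by blast
    qed
  qed
  have edge': "{\<phi>' x, \<phi>' y} \<in> edges G"
    if ab: "a \<in> S'" "b \<in> S'" "b \<in> nbrs T a" and xy: "x \<in> I a" "y \<in> I b" for a b x y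
  proof -
    \<comment> \<open>All neighbours of \<open>u\<close> in \<open>S'\<close> are mapped into side
      \<open>c\<close> of \<open>t\<close>, whether old or new, and \<open>I u\<close> is mapped
      into the common neighbourhood of that side.\<close>
    have fresh: "{\<phi>' x, \<phi>' y} \<in> edges G"
      if b: "b \<in> S'" "b \<in> nbrs T u" and x: "x \<in> I u" and y: "y \<in> I b" for b x y
    proof -
      have "\<phi>' y \<in> t c ` {..<r}"
      proof (cases "b \<in> S")
        case True
        then have "\<phi>' y = \<phi> y" "\<phi> y \<in> P" using b y old by (auto simp: P_def N_def)
        then show ?thesis using g(3) by auto
      next
        case False
        then have "b \<in> W" using b irr by (auto simp: S'_def)
        then have "y \<in> Q" using y by (auto simp: Q_def)
        then have "\<phi>' y \<in> g ` Q" using new by auto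
        then show ?thesis using g(3) by blast
      qed
      moreover have "\<phi>' x \<in> common_nbrs G r (t c)" using g(4) new x by auto
      ultimately show ?thesis by (auto simp: common_nbrs_def)
    qed
    \<comment> \<open>A vertex of \<open>W\<close> already has the neighbour \<open>u\<close>; a
      second neighbour \<open>d\<close> in \<open>S\<close> or \<open>W\<close> would lie with
      \<open>u\<close> in a linked set avoiding \<open>w\<close>, against
      \<open>tree_unique_nbr\<close>.\<close>
    have no: False if w: "w \<in> W" and d: "d \<in> S \<union> W" "d \<in> nbrs T w" for w d
    proof -
      have "w \<noteq> d" using d irr by blast
      then have "linked T (({d} \<inter> W) \<union> insert u S)" "w \<notin> ({d} \<inter> W) \<union> insert u S"
        using lW[of "{d} \<inter> W"] w W by auto
      moreover have "u \<in> nbrs T w" using w W(3) by (blast intro: nbrs_sym)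
      ultimately have "u = d" using d tree_unique_nbr[OF tree, of _ w u d] by blast
      then show False using d W u by blast
    qed
    have ba: "a \<in> nbrs T b" using ab(3) by (rule nbrs_sym)
    consider "a = u" | "b = u" | "a \<in> W" "b \<noteq> u" | "b \<in> W" "a \<noteq> u" | "a \<in> S" "b \<in> S"
      using ab by (auto simp: S'_def)
    then show ?thesis
    proof cases
      case 1
      then show ?thesis using fresh[of b x y] ab xy by simp
    next
      case 2
      then show ?thesis using fresh[of a y x] ab ba xy by (simp add: insert_commute)
    next
      case 3
      then show ?thesis using no[of a b] ab by (auto simp: S'_def)
    next
      case 4
      then show ?thesis using no[of b a] ab ba by (auto simp: S'_def)
    next
      case 5
      then have "\<phi>' x = \<phi> x" "\<phi>' y = \<phi> y" using xy old by auto
      then show ?thesis using edge 5 ab xy by simp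
    qed
  qed
  have "embeds S' \<phi>'"
    unfolding embeds_def
  proof (intro conjI ballI impI SV linked' inj' im')
    fix a b x y
    assume "a \<in> S'" "b \<in> S'" "b \<in> nbrs T a" "x \<in> I a" "y \<in> I b"
    then show "{\<phi>' x, \<phi>' y} \<in> edges G" by (rule edge')
  qed (rule closed' state'; assumption)+
  moreover have "insert u S \<subseteq> S'" by (auto simp: S'_def)
  ultimately show ?thesis by (intro exI conjI)
qed

text \<open>The invariant holds for the empty region, and an extension may add several vertices at
  once, hence strong induction on the number of missing vertices.\<close>

lemma exists_embeds_verts: "\<exists>\<phi>. embeds (verts T) \<phi>"
proof -
  have "\<exists>\<psi>. embeds (verts T) \<psi>" if "embeds S \<phi>" for S \<phi>
    using that
  proof (induction "card (verts T - S)" arbitrary: S \<phi> rule: less_induct)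
    case less
    have S: "S \<subseteq> verts T" using less.prems by (simp add: embeds_def)
    show ?case
    proof (cases "S = verts T")
      case True
      then show ?thesis using less.prems by blast
    next
      case False
      obtain u where u: "u \<in> verts T" "u \<notin> S" "S = {} \<or> (\<exists>v\<in>S. v \<in> nbrs T u)"
        using connected_crossing_edge[OF tree_basics(1,2) S _ False] S False by (cases "S = {}") blast+
      then obtain S' \<phi>' where S': "insert u S \<subseteq> S'" "embeds S' \<phi>'"
        using embeds_extend[OF less.prems] by blast
      have "card (verts T - S') < card (verts T - S)"
        using S' u tree_basics(3) by (intro psubset_card_mono) auto
      then show ?thesis using less.hyps S'(2) by blast
    qed
  qed
  moreover have "embeds {} \<phi>" for \<phi> by (auto simp: embeds_def linked_def)
  ultimately show ?thesis by blast
qed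

end

section \<open>From degeneracy to containment\<close>

text \<open>Otherwise \<open>r + 1\<close> vertices from \<open>I u\<close> and \<open>r + 1\<close>
  from the neighbouring parts span a complete bipartite subgraph, whose minimum degree exceeds
  \<open>r\<close>.\<close>

lemma degenerate_large_part:
  assumes T: "simple_graph T" and disj: "disjoint_family_on I (verts T)"
    and VF: "verts F = \<Union>(I ` verts T)"
    and EF: "edges F = {{x, y} | x y u v. {u, v} \<in> edges T \<and> x \<in> I u \<and> y \<in> I v}"
    and deg: "degenerate r F" and u: "u \<in> verts T" "r < card (I u)"
  shows "card (\<Union>(I ` nbrs T u)) \<le> r"
proof (rule ccontr)
  assume "\<not> ?thesis"
  then obtain B where B: "B \<subseteq> \<Union>(I ` nbrs T u)" "card B = Suc r"
    using obtain_subset_with_card_n[of "Suc r"] by (metis not_less_eq_eq)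
  obtain A where A: "A \<subseteq> I u" "card A = Suc r"
    using obtain_subset_with_card_n[of "Suc r" "I u"] u(2) by (metis Suc_leI)
  have fin: "finite A" "finite B" using A B by (metis card.infinite nat.distinct(1))+
  have AB: "A \<inter> B = {}"
  proof -
    have "I u \<inter> I v = {}" if "v \<in> nbrs T u" for v
      using that u(1) nbrs_subset[OF T, of u] nbrs_irrefl[OF T, of u]
      by (intro disjoint_family_onD[OF disj]) auto
    then show ?thesis using A(1) B(1) by blast
  qed
  define H where "H = \<lparr>verts = A \<union> B, edges = (\<lambda>(a, b). {a, b}) ` (A \<times> B)\<rparr>"
  have ab: "a \<noteq> b" if "a \<in> A" "b \<in> B" for a b using that AB by blast
  have "simple_graph H"
    unfolding simple_graph_def H_def using fin ab by auto
  moreover have "verts H \<subseteq> verts F"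
    using A(1) B(1) u(1) nbrs_subset[OF T, of u] unfolding H_def VF by fastforce
  moreover have "edges H \<subseteq> edges F"
    using A(1) B(1) unfolding H_def EF nbrs_def by fastforce
  moreover have "verts H \<noteq> {}" using A by (auto simp: H_def)
  ultimately have "min_degree H \<le> r" using deg unfolding degenerate_def subgraph_def by blast
  moreover have "Suc r \<le> degree H x" if x: "x \<in> verts H" for x
  proof -
    have fE: "finite {e \<in> edges H. x \<in> e}" using fin by (simp add: H_def)
    consider "x \<in> A" | "x \<in> B" using x by (auto simp: H_def)
    then show ?thesis
    proof cases
      case 1
      have "inj_on (\<lambda>b. {x, b}) B" by (auto simp: inj_on_def doubleton_eq_iff)
      moreover have "(\<lambda>b. {x, b}) ` B \<subseteq> {e \<in> edges H. x \<in> e}" using 1 by (auto simp: H_def)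
      ultimately show ?thesis using card_inj_on_le[OF _ _ fE] B(2) unfolding degree_def by metis
    next
      case 2
      have "inj_on (\<lambda>a. {a, x}) A" by (auto simp: inj_on_def doubleton_eq_iff)
      moreover have "(\<lambda>a. {a, x}) ` A \<subseteq> {e \<in> edges H. x \<in> e}" using 2 by (auto simp: H_def)
      ultimately show ?thesis using card_inj_on_le[OF _ _ fE] A(2) unfolding degree_def by metis
    qed
  qed
  then have "Suc r \<le> min_degree H"
    unfolding min_degree_def using fin A by (subst Min_ge_iff) (auto simp: H_def)
  ultimately show False by simp
qed

text \<open>The factor \<open>3 * card (verts F) + r\<close> is the \<open>M\<close> that the
  embedding requires, and \<open>L\<close> is the matching value 4 r M of
  \<open>exists_robust\<close>.\<close>

lemma contains_tree_blow_up:
  assumes F: "simple_graph F" and T: "tree T" and FT: "blow_up F T"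
    and r: "r \<ge> 1" and deg: "degenerate r F" and G: "simple_graph G"
    and L: "L = 4 * r * (3 * card (verts F) + r)"
    and e: "20 * real L * real (card (verts G)) powr (2 - 1 / real r) < real (card (edges G))"
  shows "contains_graph G F"
proof -
  obtain I where I: "disjoint_family_on I (verts T)" "verts F = \<Union>(I ` verts T)"
    "edges F = {{x, y} | x y u v. {u, v} \<in> edges T \<and> x \<in> I u \<and> y \<in> I v}"
    using FT unfolding blow_up_def by - (elim exE conjE, rule that; assumption)
  have T': "simple_graph T" using T by (simp add: tree_def)
  have "L \<ge> 1" using r by (simp add: L)
  note many = many_bicliques[OF G r this e]
  have "finite (verts G)" using G by (simp add: simple_graph_def)
  from exists_robust[OF this r L many]
  obtain \<S> where \<S>: "\<S> \<noteq> {}" "robust G r (3 * card (verts F) + r) \<S>" by blast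
  have "finite (verts F)" using F by (simp add: simple_graph_def)
  then have fin: "finite (I u)" if "u \<in> verts T" for u
    using that by (metis I(2) UN_upper finite_subset)
  have large: "card (\<Union>(I ` nbrs T u)) \<le> r" if "u \<in> verts T" "r < card (I u)" for u
    using degenerate_large_part[OF T' I deg that] .
  have bound: "3 * card (\<Union>(I ` verts T)) + r \<le> 3 * card (verts F) + r" using I(2) by simp
  interpret blow_up_host G r "3 * card (verts F) + r" \<S> T I
    by unfold_locales (fact T \<S> fin I(1) large bound)+
  obtain \<phi> where \<phi>: "embeds (verts T) \<phi>" using exists_embeds_verts by blast
  have "\<phi> ` e \<in> edges G" if "e \<in> edges F" for e
  proof -
    obtain x y u v where "e = {x, y}" "{u, v} \<in> edges T" "x \<in> I u" "y \<in> I v"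
      using \<open>e \<in> edges F\<close> unfolding I(3) by blast
    moreover from this have "u \<in> verts T" "v \<in> verts T" "v \<in> nbrs T u"
      using T' by (auto simp: simple_graph_def nbrs_def)
    ultimately show ?thesis using \<phi> unfolding embeds_def by simp
  qed
  moreover have "inj_on \<phi> (verts F)" "\<phi> ` verts F \<subseteq> verts G"
    using \<phi> unfolding embeds_def I(2) by blast+
  ultimately show ?thesis unfolding contains_graph_def by blast
qed

section \<open>The extremal bound with a constant independent of \<open>r\<close>\<close>

text \<open>Nonnegativity of \<open>b\<close> covers the case without free graphs, where
  \<open>ex\<close> takes the default value \<open>Sup {} = 0\<close>.\<close>

lemma ex_le:
  fixes b :: real
  assumes "b \<ge> 0" and "\<And>G. G \<in> free_graphs n F \<Longrightarrow> real (card (edges G)) \<le> b"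
  shows "real (ex n F) \<le> b"
proof (cases "free_graphs n F = {}")
  case True
  then show ?thesis using assms(1) by (simp add: ex_def)
next
  case False
  then have "Max ((\<lambda>G. card (edges G)) ` free_graphs n F) \<in> (\<lambda>G. card (edges G)) ` free_graphs n F"
    using finite_free_graphs by (intro Max_in) auto
  then show ?thesis using assms(2) by (auto simp: ex_eq_Max[OF False])
qed

theorem theorem1p7:
  fixes F :: "'a graph" and T :: "'b graph"
  assumes "simple_graph F" and "tree T" and "blow_up F T"
  shows "\<exists>C :: real. \<forall>r :: nat. r \<ge> 1 \<and> degenerate r F \<longrightarrow>
           (\<forall>n :: nat. real (ex n F) \<le> C * real n powr (2 - 1 / real r))"
proof (cases "\<exists>r. r \<ge> 1 \<and> degenerate r F")
  case False
  then show ?thesis by blast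
next
  case True
  \<comment> \<open>The least admissible \<open>r\<close> depends on \<open>F\<close> alone and
    gives the smallest exponent; for \<open>n \<ge> 1\<close> its bound implies the bound for every
    larger \<open>r\<close> with the same constant.\<close>
  define q where "q = (LEAST r. r \<ge> 1 \<and> degenerate r F)"
  have q: "q \<ge> 1" "degenerate q F" using LeastI_ex[OF True] by (simp_all add: q_def)
  define C where "C = 20 * real (4 * q * (3 * card (verts F) + q))"
  have C: "C \<ge> 0" by (simp add: C_def)
  have "real (ex n F) \<le> C * real n powr (2 - 1 / real r)" if r: "r \<ge> 1" "degenerate r F" for r n
  proof (cases "n = 0")
    case True
    \<comment> \<open>Here \<open>0 powr\<close> any exponent is 0, so the claim becomes that
      \<open>ex 0 F\<close> vanishes.\<close>
    have "edges G = {}" if "G \<in> free_graphs 0 F" for G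
      using that by (fastforce simp: free_graphs_def simple_graph_def)
    then have "real (ex n F) \<le> 0" using True by (intro ex_le) simp_all
    then show ?thesis using True by simp
  next
    case False
    have "q \<le> r" unfolding q_def using r by (intro Least_le) simp
    then have "2 - 1 / real q \<le> 2 - 1 / real r" using q by (simp add: frac_le)
    then have "C * real n powr (2 - 1 / real q) \<le> C * real n powr (2 - 1 / real r)"
      using C False by (intro mult_left_mono powr_mono) auto
    moreover have "real (ex n F) \<le> C * real n powr (2 - 1 / real q)"
    proof (rule ex_le)
      fix G assume G: "G \<in> free_graphs n F"
      then have "\<not> C * real (card (verts G)) powr (2 - 1 / real q) < real (card (edges G))"
        using contains_tree_blow_up[OF assms q, of G] unfolding free_graphs_def C_def by auto
      then show "real (card (edges G)) \<le> C * real n powr (2 - 1 / real q)"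
        using G by (simp add: free_graphs_def not_less)
    qed (use C in simp)
    ultimately show ?thesis by linarith
  qed
  then show ?thesis by blast
qed

end
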